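(* For every integer $p\geq 1$, every integer $\Delta\geq 1$, and every graph $G$ with maximum degree at most $\Delta$, we have \[\chi_p(G)\leq \left\lceil 2^{10}\cdot \Delta^{2-1/p}\cdot p\right\rceil.\] In particular, for fixed $\Delta$, graphs of maximum degree at most $\Delta$ admit $p$-centered colorings with $O(p)$ colors.
   Context: All graphs are finite and simple. For an integer $p\geq 1$, a vertex coloring $\phi$ of a graph $G$ is $p$-centered if for every connected subgraph $H$ of $G$, either $\phi$ uses more than $p$ colors on $V(H)$ or there is a color that appears on exactly one vertex of $H$. The $p$-centered chromatic number $\chi_p(G)$ is the minimum number of colors in a $p$-centered coloring of $G$. *)

theory Defs
  imports Complex_Main "Graph_Theory.Graph_Theory"
begin

text \<open>
  Finite simple graphs are the loop-free symmetric digraphs without parallel arcs of locale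
  \<^locale>\<open>pair_graph\<close>: an edge \<open>uv\<close> is the pair of arcs \<open>(u, v)\<close> and \<open>(v, u)\<close>, so the
  out-degree of a vertex is its number of neighbours.  The coercion \<^const>\<open>with_proj\<close> embeds
  them into general digraphs.
\<close>

definition max_degree :: "'a pair_pre_digraph \<Rightarrow> nat" where
  "max_degree G = Max (insert 0 (out_degree (with_proj G) ` pverts G))"

text \<open>
  The condition \<^term>\<open>pair_graph H\<close> makes \<open>H\<close> symmetric, so that \<open>H\<close> is a subgraph in the
  undirected sense.  The empty graph is not connected in the sense of
  \<^const>\<open>Digraph_Component.connected\<close>.
\<close>

definition p_centered :: "nat \<Rightarrow> 'a pair_pre_digraph \<Rightarrow> ('a \<Rightarrow> nat) \<Rightarrow> bool" where
  "p_centered p G \<phi> \<longleftrightarrow>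
    (\<forall>H. pair_graph H \<and> subgraph (with_proj H) (with_proj G)
          \<and> Digraph_Component.connected (with_proj H) \<longrightarrow>
        card (\<phi> ` pverts H) > p \<or> (\<exists>c. \<exists>!v. v \<in> pverts H \<and> \<phi> v = c))"

definition centered_chromatic_number :: "nat \<Rightarrow> 'a pair_pre_digraph \<Rightarrow> nat" where
  "centered_chromatic_number p G =
    (LEAST k. \<exists>\<phi>. p_centered p G \<phi> \<and> card (\<phi> ` pverts G) = k)"

text \<open>Injective colorings are \<open>p\<close>-centered, so the minimum above is attained.\<close>

lemma p_centered_if_inj:
  assumes "inj_on \<phi> (pverts G)"
  shows "p_centered p G \<phi>"
  unfolding p_centered_def
proof (intro allI impI disjI2, elim conjE)
  fix H :: "'a pair_pre_digraph"
  assume sub: "subgraph (with_proj H) (with_proj G)"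
    and conn: "Digraph_Component.connected (with_proj H)"
  from conn obtain v where v: "v \<in> pverts H"
    by (auto simp: Digraph_Component.connected_def strongly_connected_def mk_symmetric_def)
  from sub have "pverts H \<subseteq> pverts G" by (auto simp: subgraph_def)
  with assms have inj: "inj_on \<phi> (pverts H)" by (rule inj_on_subset)
  have "\<exists>!w. w \<in> pverts H \<and> \<phi> w = \<phi> v"
    using v inj by (auto dest: inj_onD)
  then show "\<exists>c. \<exists>!w. w \<in> pverts H \<and> \<phi> w = c" ..
qed

lemma centered_chromatic_number_attained:
  assumes "pair_graph G"
  shows "\<exists>\<phi>. p_centered p G \<phi> \<and> card (\<phi> ` pverts G) = centered_chromatic_number p G"
proof -
  interpret pair_graph G by fact
  obtain \<phi> :: "'a \<Rightarrow> nat" where "inj_on \<phi> (pverts G)"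
    using finite_imp_inj_to_nat_seg[OF pair_finite_verts] by blast
  then have "\<exists>k \<phi>. p_centered p G \<phi> \<and> card (\<phi> ` pverts G) = k"
    using p_centered_if_inj by blast
  then show ?thesis
    unfolding centered_chromatic_number_def by (rule LeastI_ex)
qed

end

theory Submission
  imports Defs
begin

text \<open>
  A counting argument in the style of Rosenfeld.  With \<open>M \<ge> 2\<beta>\<close> colors, adding a vertex \<open>v\<close> to \<open>S\<close>
  multiplies the number of \<open>p\<close>-centered colorings by at least \<open>\<beta>\<close>.  Indeed, an extension that is
  not \<open>p\<close>-centered has a connected \<open>H\<close> containing \<open>v\<close>, with \<open>q \<le> p\<close> colors, none used once.  Keep one vertex
  (other than \<open>v\<close>) of each color of \<open>H\<close> and erase the rest: \<open>|H| - q \<ge> |H| / 2\<close> vertices are erased, at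
  most \<open>q\<close> choices for each suffice to recover them, and by induction every erased vertex other than
  \<open>v\<close> saves a factor \<open>\<beta>\<close>.  There are at most \<open>3 (6 \<Delta>) ^ (n - 1)\<close> connected sets of size \<open>n\<close> containing
  \<open>v\<close>, and \<open>(2 - 1/p) (n - q) \<ge> n - 1\<close> because \<open>q \<le> p\<close> and \<open>2 q \<le> n\<close>; so for
  \<open>\<beta> = 256 p \<Delta> powr (2 - 1/p)\<close> the number of bad extensions is at most \<open>\<beta>\<close> times the number of colorings of \<open>S\<close>.
\<close>

section \<open>Linked sets and centered colorings\<close>

text \<open>Connectivity is stated through cuts, which directly yields the next vertex when a
  cluster is explored. The empty set is linked, hence the separate condition
  \<open>H \<noteq> {}\<close> in \<open>centered_on\<close>.\<close>

definition linked :: "('a \<Rightarrow> 'a \<Rightarrow> bool) \<Rightarrow> 'a set \<Rightarrow> bool" where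
  "linked E H \<longleftrightarrow> (\<forall>A. A \<subset> H \<and> A \<noteq> {} \<longrightarrow> (\<exists>a\<in>A. \<exists>b\<in>H - A. E a b))"

definition boundary :: "'a set \<Rightarrow> ('a \<Rightarrow> 'a \<Rightarrow> bool) \<Rightarrow> 'a set \<Rightarrow> 'a set" where
  "boundary V E H = {u \<in> V - H. \<exists>h\<in>H. E h u}"

text \<open>Vertex sets replace subgraphs, since only the colors on the vertices matter.\<close>

definition centered_on :: "nat \<Rightarrow> ('a \<Rightarrow> 'a \<Rightarrow> bool) \<Rightarrow> 'a set \<Rightarrow> ('a \<Rightarrow> nat) \<Rightarrow> bool" where
  "centered_on p E S \<phi> \<longleftrightarrow>
    (\<forall>H\<subseteq>S. linked E H \<and> H \<noteq> {} \<longrightarrow> card (\<phi> ` H) > p \<or> (\<exists>c. \<exists>!v. v \<in> H \<and> \<phi> v = c))"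

text \<open>Values outside \<open>S\<close> are fixed by \<open>\<rightarrow>\<^sub>E\<close>, so
  that each coloring of \<open>S\<close> is counted once.\<close>

definition centered_colorings ::
    "nat \<Rightarrow> ('a \<Rightarrow> 'a \<Rightarrow> bool) \<Rightarrow> nat \<Rightarrow> 'a set \<Rightarrow> ('a \<Rightarrow> nat) set" where
  "centered_colorings p E M S = {\<phi> \<in> S \<rightarrow>\<^sub>E {..<M}. centered_on p E S \<phi>}"

lemma finite_centered_colorings: "finite S \<Longrightarrow> finite (centered_colorings p E M S)"
  unfolding centered_colorings_def by (simp add: finite_PiE)

lemma centered_on_mono: "centered_on p E S \<phi> \<Longrightarrow> T \<subseteq> S \<Longrightarrow> centered_on p E T \<phi>"
  unfolding centered_on_def by blast

lemma centered_on_cong: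
  assumes "\<And>x. x \<in> S \<Longrightarrow> \<phi> x = \<psi> x"
  shows "centered_on p E S \<phi> \<longleftrightarrow> centered_on p E S \<psi>"
proof -
  have "\<phi> ` H = \<psi> ` H \<and> (\<forall>c v. (v \<in> H \<and> \<phi> v = c) = (v \<in> H \<and> \<psi> v = c))" if "H \<subseteq> S" for H
  proof (intro conjI allI)
    show "\<phi> ` H = \<psi> ` H"
      using assms that by (intro image_cong) auto
  qed (use assms that in auto)
  then show ?thesis
    unfolding centered_on_def by simp
qed

section \<open>Counting connected sets through a vertex\<close>

text \<open>
  The weight of \<open>H\<close> is the probability that \<open>H\<close> is the cluster of \<open>A\<close> in site percolation with
  parameter \<open>x\<close>, where \<open>X\<close> is known to be closed.
\<close>

lemma percolation_sum_le_1:
  fixes x :: real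
  assumes "finite V" "A \<subseteq> V" "A \<noteq> {}" "X \<subseteq> V - A" "0 \<le> x" "x \<le> 1"
  shows "(\<Sum>H | A \<subseteq> H \<and> H \<subseteq> V - X \<and> linked E H.
            x ^ card (H - A) * (1 - x) ^ card (boundary V E H - X)) \<le> 1"
  using assms
\<comment> \<open>\<open>A\<close> is known open and \<open>X\<close> known closed; the measure
  counts the undecided vertices.\<close>
proof (induction "card (V - A - X)" arbitrary: A X rule: less_induct)
  case less
  let ?F = "\<lambda>A X. {H. A \<subseteq> H \<and> H \<subseteq> V - X \<and> linked E H}"
  let ?w = "\<lambda>A X H. x ^ card (H - A) * (1 - x) ^ card (boundary V E H - X)"
  have finF: "finite (?F A X)" for A X
    by (rule finite_subset[of _ "Pow V"]) (use \<open>finite V\<close> in auto)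
  show ?case
  proof (cases "boundary V E A - X = {}")
    case True
    have "?F A X \<subseteq> {A}"
    proof
      fix H assume H: "H \<in> ?F A X"
      have "H = A"
      proof (rule ccontr)
        assume "H \<noteq> A"
        then have "A \<subset> H" using H by auto
        with H \<open>A \<noteq> {}\<close> obtain a b where "a \<in> A" "b \<in> H - A" "E a b"
          unfolding linked_def by blast
        with H have "b \<in> boundary V E A - X" unfolding boundary_def by auto
        with True show False by blast
      qed
      then show "H \<in> {A}" by simp
    qed
    then have "sum (?w A X) (?F A X) \<le> sum (?w A X) {A}"
      using less.prems by (intro sum_mono2) auto
    also have "\<dots> \<le> 1" using less.prems by (simp add: power_le_one)
    finally show ?thesis .
  next
    case False
    \<comment> \<open>Condition on the undecided neighbor \<open>u\<close>: with weight
      \<open>x\<close> it joins \<open>A\<close>, with weight \<open>1 - x\<close> it joins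
      \<open>X\<close>.\<close>
    then obtain u where u: "u \<in> boundary V E A" "u \<notin> X" by auto
    then have uV: "u \<in> V" "u \<notin> A" unfolding boundary_def by auto
    have split: "?F A X = ?F (insert u A) X \<union> ?F A (insert u X)" by auto
    have disj: "?F (insert u A) X \<inter> ?F A (insert u X) = {}" by auto
    have lt: "card (V - insert u A - X) < card (V - A - X)"
             "card (V - A - insert u X) < card (V - A - X)"
      using u uV \<open>finite V\<close> by (intro psubset_card_mono; auto)+
    have incl: "?w A X H = x * ?w (insert u A) X H" if "H \<in> ?F (insert u A) X" for H
    proof -
      have "finite H" using that \<open>finite V\<close> by (auto intro: finite_subset)
      moreover have "H - A = insert u (H - insert u A)" using that uV by auto
      ultimately have "card (H - A) = Suc (card (H - insert u A))"
        by (metis DiffD2 card_insert_disjoint finite_Diff insertI1)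
      then show ?thesis by simp
    qed
    have excl: "?w A X H = (1 - x) * ?w A (insert u X) H" if "H \<in> ?F A (insert u X)" for H
    proof -
      \<comment> \<open>\<open>u\<close> is outside \<open>H\<close> but adjacent to
        \<open>A \<subseteq> H\<close>, hence on the boundary of \<open>H\<close>.\<close>
      have "boundary V E H - X = insert u (boundary V E H - insert u X)"
        using that u unfolding boundary_def by auto
      moreover have "finite (boundary V E H)"
        using \<open>finite V\<close> unfolding boundary_def by simp
      ultimately have "card (boundary V E H - X) = Suc (card (boundary V E H - insert u X))"
        by (metis DiffD2 card_insert_disjoint finite_Diff insertI1)
      then show ?thesis by simp
    qed
    have "sum (?w A X) (?F A X)
        = sum (?w A X) (?F (insert u A) X) + sum (?w A X) (?F A (insert u X))"
      unfolding split by (rule sum.union_disjoint[OF finF finF disj])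
    also have "\<dots> = x * sum (?w (insert u A) X) (?F (insert u A) X)
                  + (1 - x) * sum (?w A (insert u X)) (?F A (insert u X))"
      unfolding sum_distrib_left using incl excl by (intro arg_cong2[where f = "(+)"] sum.cong) auto
    also have "\<dots> \<le> x * 1 + (1 - x) * 1"
    proof (intro add_mono mult_left_mono)
      show "sum (?w (insert u A) X) (?F (insert u A) X) \<le> 1"
        using less.prems u uV by (intro less.hyps lt) auto
      show "sum (?w A (insert u X)) (?F A (insert u X)) \<le> 1"
        using less.prems u uV by (intro less.hyps lt) auto
    qed (use less.prems in auto)
    finally show ?thesis by simp
  qed
qed

lemma card_boundary_le:
  assumes "finite V" "H \<subseteq> V" "\<And>h. h \<in> V \<Longrightarrow> card {u \<in> V. E h u} \<le> \<Delta>"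
  shows "card (boundary V E H) \<le> \<Delta> * card H"
proof -
  have "finite H" using assms finite_subset by blast
  have "boundary V E H \<subseteq> (\<Union>h\<in>H. {u \<in> V. E h u})" unfolding boundary_def by auto
  then have "card (boundary V E H) \<le> card (\<Union>h\<in>H. {u \<in> V. E h u})"
    using assms \<open>finite H\<close> by (intro card_mono) auto
  also have "\<dots> \<le> (\<Sum>h\<in>H. card {u \<in> V. E h u})" by (rule card_UN_le[OF \<open>finite H\<close>])
  also have "\<dots> \<le> (\<Sum>h\<in>H. \<Delta>)" using assms by (intro sum_mono) auto
  finally show ?thesis by (simp add: mult.commute)
qed

text \<open>Percolation started at \<open>{v}\<close>: a set of size \<open>n\<close> has at most
  \<open>\<Delta> * n\<close> boundary vertices, so its weight is at least
  \<open>(1 / (2 * \<Delta>)) ^ (n - 1) * (1 / 3) ^ n\<close>. All sizes are handled by a single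
  sum.\<close>

lemma sum_linked_le_1:
  assumes "finite V" "v \<in> V" "1 \<le> \<Delta>" "\<And>h. h \<in> V \<Longrightarrow> card {u \<in> V. E h u} \<le> \<Delta>"
  shows "(\<Sum>H | v \<in> H \<and> H \<subseteq> V \<and> linked E H. 1 / (3 * (6 * real \<Delta>) ^ (card H - 1))) \<le> 1"
proof -
  \<comment> \<open>This choice gives \<open>1 - x = 1 / (1 + 1 / \<Delta>)\<close>, so
    \<open>(1 - x) ^ \<Delta>\<close> is at least \<open>1 / exp 1\<close>.\<close>
  define x :: real where "x = 1 / (real \<Delta> + 1)"
  have x: "0 \<le> x" "x \<le> 1" unfolding x_def by auto
  have x_ge: "1 / (2 * real \<Delta>) \<le> x"
    unfolding x_def using assms by (simp add: frac_le)
  have "(1 + 1 / real \<Delta>) ^ \<Delta> \<le> exp (1 / real \<Delta>) ^ \<Delta>"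
    by (intro power_mono) auto
  also have "\<dots> = exp 1" using assms by (simp flip: exp_of_nat_mult)
  also have "\<dots> \<le> 3" by (rule exp_le)
  finally have "(1 + 1 / real \<Delta>) ^ \<Delta> \<le> 3" .
  then have "1 / 3 \<le> 1 / (1 + 1 / real \<Delta>) ^ \<Delta>"
    by (intro divide_left_mono) (auto intro!: zero_less_power add_pos_nonneg)
  also have "1 / (1 + 1 / real \<Delta>) ^ \<Delta> = (1 - x) ^ \<Delta>"
    unfolding x_def using assms by (simp add: field_simps flip: power_one_over power_divide)
  finally have third: "1 / 3 \<le> (1 - x) ^ \<Delta>" .
  have "(\<Sum>H | v \<in> H \<and> H \<subseteq> V \<and> linked E H. 1 / (3 * (6 * real \<Delta>) ^ (card H - 1)))
     \<le> (\<Sum>H | v \<in> H \<and> H \<subseteq> V \<and> linked E H. x ^ card (H - {v}) * (1 - x) ^ card (boundary V E H - {}))"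
  proof (rule sum_mono)
    fix H assume "H \<in> {H. v \<in> H \<and> H \<subseteq> V \<and> linked E H}"
    then have H: "v \<in> H" "H \<subseteq> V" by auto
    then have "finite H" using assms finite_subset by blast
    then obtain m where m: "card H = Suc m" using H by (metis card_Suc_Diff1)
    then have m': "card (H - {v}) = m" using H by simp
    have "1 / (3 * (6 * real \<Delta>) ^ m) = (1 / (2 * real \<Delta>)) ^ m * (1 / 3) ^ card H"
    proof -
      have "(6 * real \<Delta>) ^ m = (2 * real \<Delta>) ^ m * 3 ^ m"
        using power_mult_distrib[of "2 * real \<Delta>" 3 m] by (simp add: mult.commute)
      then show ?thesis by (simp add: m power_one_over)
    qed
    also have "\<dots> \<le> x ^ m * ((1 - x) ^ \<Delta>) ^ card H"
      using x x_ge third by (intro mult_mono power_mono) auto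
    also have "\<dots> \<le> x ^ m * (1 - x) ^ card (boundary V E H)"
      unfolding power_mult[symmetric] using x card_boundary_le[OF assms(1) H(2) assms(4)]
      by (intro mult_left_mono power_decreasing) auto
    finally show "1 / (3 * (6 * real \<Delta>) ^ (card H - 1))
        \<le> x ^ card (H - {v}) * (1 - x) ^ card (boundary V E H - {})"
      using m m' by simp
  qed
  also have "\<dots> \<le> 1"
    using percolation_sum_le_1[of V "{v}" "{}" x E] assms x by simp
  finally show ?thesis .
qed

section \<open>Numerical estimates\<close>

lemma power_powr_ge:
  assumes "1 \<le> \<Delta>" "q \<le> p" "1 \<le> p" "2 * q \<le> n" "1 \<le> n"
  shows "real \<Delta> ^ (n - 1) \<le> (real \<Delta> powr (2 - 1 / real p)) ^ (n - q)"
proof -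
  \<comment> \<open>The difference of the exponents, split into two nonnegative terms. Both vanish
    for \<open>q = p\<close> and \<open>n = 2 * p\<close>, the case that dictates
    \<open>2 - 1 / p\<close>.\<close>
  have "0 \<le> (real n - 2 * real q) * (1 - 1 / real p) + (1 - real q / real p)"
    using assms by (intro add_nonneg_nonneg mult_nonneg_nonneg) (auto simp: of_nat_le_iff)
  also have "\<dots> = (2 - 1 / real p) * (real n - real q) - (real n - 1)"
    using assms by (simp add: field_simps)
  finally have le: "real (n - 1) \<le> (2 - 1 / real p) * real (n - q)"
    using assms by (simp add: of_nat_diff)
  have "real \<Delta> ^ (n - 1) = real \<Delta> powr real (n - 1)"
    using assms by (subst powr_realpow) auto
  also have "\<dots> \<le> real \<Delta> powr ((2 - 1 / real p) * real (n - q))"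
    using assms le by (intro powr_mono) auto
  also have "\<dots> = (real \<Delta> powr (2 - 1 / real p)) ^ (n - q)"
    using assms by (simp add: powr_power mult.commute)
  finally show ?thesis .
qed

text \<open>On the left, \<open>2 ^ (n - 1)\<close> bounds the choices of representatives,
  \<open>q ^ (n - q)\<close> counts the copying maps, and the denominator is the saving by erased
  vertices other than \<open>v\<close>. The right side is \<beta> times the summand of
  \<open>sum_linked_le_1\<close>.\<close>

lemma weight_le:
  assumes "1 \<le> \<Delta>" "1 \<le> p" "q \<le> p" "1 \<le> q" "2 * q \<le> n"
    and \<beta>: "\<beta> = 256 * real \<Delta> powr (2 - 1 / real p) * real p"
  shows "2 ^ (n - 1) * real q ^ (n - q) / \<beta> ^ (n - q - 1)
       \<le> \<beta> * (1 / (3 * (6 * real \<Delta>) ^ (n - 1)))"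
proof -
  define D where "D = real \<Delta> powr (2 - 1 / real p)"
  have D: "0 < D" unfolding D_def using assms by simp
  then have \<beta>0: "0 < \<beta>" unfolding \<beta> D_def[symmetric] using assms by simp
  define m where "m = n - q"
  have m: "1 \<le> m" "n \<le> 2 * m" "1 \<le> n" using assms unfolding m_def by auto
  have "real q ^ m / \<beta> ^ (m - 1) = \<beta> * (real q ^ m / \<beta> ^ m)"
    using \<beta>0 m by (simp add: power_eq_if)
  also have "\<dots> \<le> \<beta> * (real p ^ m / \<beta> ^ m)"
    using \<beta>0 assms by (intro mult_left_mono divide_right_mono power_mono) auto
  also have "real p ^ m / \<beta> ^ m = 1 / (256 ^ m * D ^ m)"
    unfolding \<beta> D_def[symmetric] using D assms by (simp add: power_mult_distrib)
  also have "\<dots> \<le> 1 / (16 ^ n * real \<Delta> ^ (n - 1))"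
  proof (intro divide_left_mono mult_mono)
    \<comment> \<open>Here 256 is used as the square of 16: at least half of the \<open>n\<close>
      vertices are erased.\<close>
    have "(16::real) ^ n \<le> 16 ^ (2 * m)" using m by (intro power_increasing) auto
    then show "(16::real) ^ n \<le> 256 ^ m" by (simp add: power_mult)
    show "real \<Delta> ^ (n - 1) \<le> D ^ m"
      unfolding D_def m_def using assms m by (intro power_powr_ge) auto
  qed (use D assms in auto)
  finally have *: "real q ^ m / \<beta> ^ (m - 1) \<le> \<beta> * (1 / (16 ^ n * real \<Delta> ^ (n - 1)))"
    using \<beta>0 by simp
  have "2 ^ (n - 1) * real q ^ m / \<beta> ^ (m - 1)
      \<le> 2 ^ (n - 1) * (\<beta> * (1 / (16 ^ n * real \<Delta> ^ (n - 1))))"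
    using mult_left_mono[OF *, of "2 ^ (n - 1)"] by simp
  also have "\<dots> = \<beta> * (1 / (16 * (8 * real \<Delta>) ^ (n - 1)))"
  proof -
    \<comment> \<open>One factor \<open>2 ^ (n - 1)\<close> pays for the choice of \<open>R\<close>;
      the remaining \<open>16 * 8 ^ (n - 1)\<close> exceeds \<open>3 * 6 ^ (n - 1)\<close>.\<close>
    have "(16::real) ^ n = 16 * (8 ^ (n - 1) * 2 ^ (n - 1))"
      using m power_mult_distrib[of "8::real" 2 "n - 1"] by (simp add: power_eq_if)
    then show ?thesis by (simp add: power_mult_distrib)
  qed
  also have "\<dots> \<le> \<beta> * (1 / (3 * (6 * real \<Delta>) ^ (n - 1)))"
    using \<beta>0 assms by (intro mult_left_mono divide_left_mono mult_mono power_mono) auto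
  finally show ?thesis unfolding m_def .
qed

section \<open>Encoding extensions that are not centered\<close>

lemma obtain_representatives:
  assumes "finite H" "v \<in> H" and nu: "\<not> (\<exists>c. \<exists>!w. w \<in> H \<and> \<phi> w = c)"
  obtains R f where "R \<subseteq> H - {v}" "card R = card (\<phi> ` H)" "2 * card R \<le> card H"
    "f \<in> (H - R) \<rightarrow>\<^sub>E R" "\<And>h. h \<in> H - R \<Longrightarrow> \<phi> h = \<phi> (f h)"
proof -
  have another: "\<exists>w\<in>H. w \<noteq> u \<and> \<phi> w = \<phi> u" if "u \<in> H" for u
    using nu that by metis
  \<comment> \<open>Every color of \<open>H\<close> occurs at least twice, so its representative can
    avoid \<open>v\<close>; thus \<open>v\<close> is always erased.\<close>
  have "\<exists>w. w \<in> H - {v} \<and> \<phi> w = c" if "c \<in> \<phi> ` H" for c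
    using that another by (metis DiffI imageE singletonD)
  then obtain r where r: "\<And>c. c \<in> \<phi> ` H \<Longrightarrow> r c \<in> H - {v} \<and> \<phi> (r c) = c"
    by metis
  define R where "R = r ` \<phi> ` H"
  have RH: "R \<subseteq> H - {v}" unfolding R_def using r by auto
  have "inj_on r (\<phi> ` H)" using r by (metis inj_onI)
  then have cR: "card R = card (\<phi> ` H)" unfolding R_def by (rule card_image)
  \<comment> \<open>\<open>R\<close> takes only one vertex of each color, so every color survives on
    \<open>H - R\<close>; this gives \<open>2 * card R \<le> card H\<close>.\<close>
  have "\<phi> ` H \<subseteq> \<phi> ` (H - R)"
  proof
    fix c assume c: "c \<in> \<phi> ` H"
    then obtain w where w: "w \<in> H" "w \<noteq> r c" "\<phi> w = c" using another[of "r c"] r by fastforce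
    then have "w \<notin> R" unfolding R_def using r by fastforce
    with w show "c \<in> \<phi> ` (H - R)" by auto
  qed
  then have "card R \<le> card (\<phi> ` (H - R))"
    unfolding cR using assms by (intro card_mono) auto
  also have "\<dots> \<le> card (H - R)" using assms by (intro card_image_le) auto
  also have "\<dots> = card H - card R"
    using RH assms(1) by (intro card_Diff_subset) (auto intro: finite_subset)
  finally have "2 * card R \<le> card H"
    using card_mono[of H R] RH assms(1) by auto
  moreover have "restrict (r \<circ> \<phi>) (H - R) \<in> (H - R) \<rightarrow>\<^sub>E R" unfolding R_def by auto
  moreover have "\<phi> h = \<phi> (restrict (r \<circ> \<phi>) (H - R) h)" if "h \<in> H - R" for h
    using that r by auto
  ultimately show ?thesis using that RH cR by blast
qed

text \<open>
  Erasing the colors on \<open>H - R\<close> loses no information once \<open>f\<close> is known.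
\<close>

lemma card_copying_colorings_le:
  assumes "finite S" "R \<subseteq> H - {v}" "v \<in> H" "f \<in> (H - R) \<rightarrow>\<^sub>E R" "H \<subseteq> insert v S"
  shows "card {\<phi> \<in> insert v S \<rightarrow>\<^sub>E {..<M}. centered_on p E S \<phi> \<and> (\<forall>h\<in>H - R. \<phi> h = \<phi> (f h))}
       \<le> card (centered_colorings p E M (S - (H - R)))" (is "card ?B \<le> _")
proof (rule card_inj_on_le)
  let ?T = "S - (H - R)"
  let ?C = "centered_colorings p E M"
  show "finite (?C ?T)" using assms by (simp add: finite_centered_colorings)
  have T: "insert v S = ?T \<union> (H - R)" using assms by auto
  show "inj_on (\<lambda>\<phi>. restrict \<phi> ?T) ?B"
  proof (rule inj_onI)
    fix \<phi> \<psi> assume \<phi>: "\<phi> \<in> ?B" and \<psi>: "\<psi> \<in> ?B" and eq: "restrict \<phi> ?T = restrict \<psi> ?T"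
    have onT: "\<phi> x = \<psi> x" if "x \<in> ?T" for x using eq that by (metis restrict_apply')
    have "R \<subseteq> ?T" using assms by auto
    have "\<phi> x = \<psi> x" if "x \<in> insert v S" for x
    proof (cases "x \<in> ?T")
      case False
      then have x: "x \<in> H - R" using that T by auto
      \<comment> \<open>The erased color at \<open>x\<close> is read off at \<open>f x\<close>,
        which is kept.\<close>
      then have "f x \<in> ?T" using assms(4) \<open>R \<subseteq> ?T\<close> by auto
      then show ?thesis using \<phi> \<psi> x onT by auto
    qed (rule onT)
    then show "\<phi> = \<psi>" using \<phi> \<psi> by (intro PiE_ext[of \<phi> "insert v S"]) auto
  qed
  show "(\<lambda>\<phi>. restrict \<phi> ?T) ` ?B \<subseteq> ?C ?T"
  proof
    fix \<psi> assume "\<psi> \<in> (\<lambda>\<phi>. restrict \<phi> ?T) ` ?B"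
    then obtain \<phi> where \<phi>: "\<phi> \<in> ?B" "\<psi> = restrict \<phi> ?T" by auto
    have "centered_on p E ?T \<phi>" using \<phi> by (auto intro: centered_on_mono)
    then have "centered_on p E ?T \<psi>"
      using centered_on_cong[of ?T \<phi> \<psi>] \<phi> by simp
    then show "\<psi> \<in> ?C ?T" using \<phi> unfolding centered_colorings_def by auto
  qed
qed

text \<open>The color of \<open>v\<close> is free, because centeredness is required on
  \<open>S\<close> only.\<close>

lemma card_extensions:
  assumes "finite S" "v \<notin> S"
  shows "card {\<phi> \<in> insert v S \<rightarrow>\<^sub>E {..<M}. centered_on p E S \<phi>}
       = M * card (centered_colorings p E M S)"
proof -
  let ?g = "\<lambda>(c, \<phi>). \<phi>(v := c)"
  have "bij_betw ?g ({..<M} \<times> centered_colorings p E M S)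
          {\<phi> \<in> insert v S \<rightarrow>\<^sub>E {..<M}. centered_on p E S \<phi>}"
  proof (rule bij_betw_imageI)
    show "inj_on ?g ({..<M} \<times> centered_colorings p E M S)"
    proof (rule inj_onI, clarify)
      fix c \<phi> d \<psi>
      assume \<phi>: "\<phi> \<in> centered_colorings p E M S" and \<psi>: "\<psi> \<in> centered_colorings p E M S"
        and eq: "\<phi>(v := c) = \<psi>(v := d)"
      have "c = d" using fun_cong[OF eq, of v] by simp
      moreover have "\<phi> = \<psi>"
      proof (rule PiE_ext)
        show "\<phi> \<in> S \<rightarrow>\<^sub>E {..<M}" "\<psi> \<in> S \<rightarrow>\<^sub>E {..<M}"
          using \<phi> \<psi> unfolding centered_colorings_def by auto
        show "\<phi> x = \<psi> x" if "x \<in> S" for x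
          using fun_cong[OF eq, of x] that assms by (auto split: if_splits)
      qed
      ultimately show "c = d \<and> \<phi> = \<psi>" by simp
    qed
    show "?g ` ({..<M} \<times> centered_colorings p E M S)
        = {\<phi> \<in> insert v S \<rightarrow>\<^sub>E {..<M}. centered_on p E S \<phi>}" (is "?L = ?R")
    proof
      show "?L \<subseteq> ?R"
      proof clarify
        fix c \<phi> assume c: "c < M" and \<phi>: "\<phi> \<in> centered_colorings p E M S"
        have "centered_on p E S (\<phi>(v := c)) \<longleftrightarrow> centered_on p E S \<phi>"
          using assms by (intro centered_on_cong) auto
        then show "\<phi>(v := c) \<in> insert v S \<rightarrow>\<^sub>E {..<M} \<and> centered_on p E S (\<phi>(v := c))"
          using c \<phi> unfolding centered_colorings_def by (simp add: PiE_fun_upd)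
      qed
      show "?R \<subseteq> ?L"
      proof
        fix \<phi> assume \<phi>: "\<phi> \<in> ?R"
        have "centered_on p E S (restrict \<phi> S)"
          using \<phi> centered_on_cong[of S "restrict \<phi> S" \<phi>] by simp
        then have "restrict \<phi> S \<in> centered_colorings p E M S"
          using \<phi> unfolding centered_colorings_def by auto
        moreover have "\<phi> = ?g (\<phi> v, restrict \<phi> S)"
          using \<phi> by (auto simp: fun_eq_iff restrict_def PiE_def extensional_def)
        ultimately show "\<phi> \<in> ?L" using \<phi> by (intro image_eqI[of _ _ "(\<phi> v, restrict \<phi> S)"]) auto
      qed
    qed
  qed
  from bij_betw_same_card[OF this] show ?thesis
    by (simp add: card_cartesian_product)
qed

section \<open>Growth of the number of centered colorings\<close>

text \<open>The one-vertex bound is iterated over \<open>D\<close>. Since \<open>step\<close>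
  concerns only \<open>T\<close> with \<open>insert u T \<subseteq> S\<close>, the induction
  hypothesis of the next lemma can supply it.\<close>

lemma card_centered_colorings_Diff_le:
  fixes \<beta> :: real
  assumes "finite S" "D \<subseteq> S" "0 < \<beta>"
    and step: "\<And>T u. insert u T \<subseteq> S \<Longrightarrow> u \<notin> T \<Longrightarrow>
      \<beta> * card (centered_colorings p E M T) \<le> card (centered_colorings p E M (insert u T))"
  shows "\<beta> ^ card D * card (centered_colorings p E M (S - D)) \<le> card (centered_colorings p E M S)"
proof -
  have "finite D" using assms finite_subset by blast
  then show ?thesis using assms(2)
  proof (induction D rule: finite_induct)
    case (insert x D)
    have "\<beta> * card (centered_colorings p E M (S - insert x D))
        \<le> card (centered_colorings p E M (insert x (S - insert x D)))"
      using insert by (intro step) auto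
    also have "insert x (S - insert x D) = S - D" using insert by auto
    finally have "\<beta> ^ card D * (\<beta> * card (centered_colorings p E M (S - insert x D)))
        \<le> \<beta> ^ card D * card (centered_colorings p E M (S - D))"
      using assms(3) by (intro mult_left_mono) auto
    also have "\<dots> \<le> card (centered_colorings p E M S)" using insert by auto
    finally show ?case using insert by (simp add: mult_ac)
  qed simp
qed

lemma card_centered_colorings_insert_ge:
  fixes \<beta> :: real
  assumes "1 \<le> \<Delta>" "1 \<le> p"
    and \<beta>: "\<beta> = 256 * real \<Delta> powr (2 - 1 / real p) * real p" and M: "2 * \<beta> \<le> real M"
    and "finite V" and deg: "\<And>h. h \<in> V \<Longrightarrow> card {u \<in> V. E h u} \<le> \<Delta>"
    and "insert v S \<subseteq> V" "v \<notin> S"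
  shows "\<beta> * card (centered_colorings p E M S) \<le> card (centered_colorings p E M (insert v S))"
  using assms(7,8)
proof (induction "card S" arbitrary: S v rule: less_induct)
  case less
  let ?C = "centered_colorings p E M"
  let ?W = "insert v S"
  let ?H = "{H. v \<in> H \<and> H \<subseteq> ?W \<and> linked E H}"
  let ?R = "\<lambda>H. {R. R \<subseteq> H - {v} \<and> 1 \<le> card R \<and> card R \<le> p \<and> 2 * card R \<le> card H}"
  \<comment> \<open>\<open>?X\<close> collects all extensions to \<open>v\<close>;
    \<open>?B H R f\<close> those whose colors on \<open>H - R\<close> are copied from
    \<open>R\<close> along \<open>f\<close>.\<close>
  let ?X = "{\<phi> \<in> ?W \<rightarrow>\<^sub>E {..<M}. centered_on p E S \<phi>}"
  let ?B = "\<lambda>H R f. {\<phi> \<in> ?W \<rightarrow>\<^sub>E {..<M}. centered_on p E S \<phi> \<and> (\<forall>h\<in>H - R. \<phi> h = \<phi> (f h))}"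
  have finS: "finite S" using less.prems \<open>finite V\<close> by (auto intro: finite_subset)
  have \<beta>0: "0 < \<beta>" unfolding \<beta> using assms by simp
  have finH: "finite ?H" by (rule finite_subset[of _ "Pow ?W"]) (use finS in auto)
  have finHH: "finite H" if "H \<in> ?H" for H using that finS by (auto intro: finite_subset)
  have finR: "finite (?R H)" if "H \<in> ?H" for H
    by (rule finite_subset[of _ "Pow H"]) (use finHH[OF that] in auto)
  have cB: "card (?B H R f) \<le> card (?C S) / \<beta> ^ (card H - card R - 1)"
    if H: "H \<in> ?H" and R: "R \<in> ?R H" and f: "f \<in> (H - R) \<rightarrow>\<^sub>E R" for H R f
  proof -
    \<comment> \<open>\<open>v\<close> is erased too but is not in \<open>S\<close>, so it saves no
      factor; hence the \<open>- 1\<close> in the exponent.\<close>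
    let ?D = "H - R - {v}"
    have "finite R" using R finHH[OF H] by (auto intro: finite_subset)
    then have cD: "card ?D = card H - card R - 1"
      using H R by (subst card_Diff_singleton) (auto simp: card_Diff_subset subset_Diff_insert)
    have "card (?B H R f) \<le> card (?C (S - (H - R)))"
      using H R f finS by (intro card_copying_colorings_le) auto
    also have "S - (H - R) = S - ?D" using less.prems by auto
    finally have le: "real (card (?B H R f)) \<le> real (card (?C (S - ?D)))" by simp
    have "\<beta> ^ card ?D * card (?C (S - ?D)) \<le> card (?C S)"
    proof (rule card_centered_colorings_Diff_le[OF finS _ \<beta>0])
      show "?D \<subseteq> S" using H by auto
      fix T u assume "insert u T \<subseteq> S" "u \<notin> T"
      moreover from this have "card T < card S" using finS by (intro psubset_card_mono) auto
      ultimately show "\<beta> * card (?C T) \<le> card (?C (insert u T))"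
        using less.prems by (intro less.hyps) auto
    qed
    with le have "\<beta> ^ card ?D * card (?B H R f) \<le> card (?C S)"
      using \<beta>0 by (meson less_imp_le mult_left_mono order_trans zero_le_power)
    then show ?thesis using \<beta>0 by (simp add: cD field_simps)
  qed
  have "?X - ?C ?W \<subseteq> (\<Union>H\<in>?H. \<Union>R\<in>?R H. \<Union>f\<in>(H - R) \<rightarrow>\<^sub>E R. ?B H R f)"
  proof
    fix \<phi> assume \<phi>: "\<phi> \<in> ?X - ?C ?W"
    then have "\<not> centered_on p E ?W \<phi>" unfolding centered_colorings_def by auto
    then obtain H where H: "H \<subseteq> ?W" "linked E H" "H \<noteq> {}" "card (\<phi> ` H) \<le> p"
      "\<not> (\<exists>c. \<exists>!w. w \<in> H \<and> \<phi> w = c)"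
      unfolding centered_on_def by (auto simp: not_less)
    \<comment> \<open>A violating set inside \<open>S\<close> would contradict centeredness on
      \<open>S\<close>.\<close>
    have "v \<in> H"
    proof (rule ccontr)
      assume "v \<notin> H"
      then have "H \<subseteq> S" using H by auto
      moreover have "centered_on p E S \<phi>" using \<phi> by auto
      ultimately have "p < card (\<phi> ` H)" using H unfolding centered_on_def by metis
      with H(4) show False by simp
    qed
    then have "H \<in> ?H" using H by auto
    note fH = finHH[OF this]
    obtain R f where Rf: "R \<subseteq> H - {v}" "card R = card (\<phi> ` H)" "2 * card R \<le> card H"
      "f \<in> (H - R) \<rightarrow>\<^sub>E R" "\<And>h. h \<in> H - R \<Longrightarrow> \<phi> h = \<phi> (f h)"
      using obtain_representatives[OF fH \<open>v \<in> H\<close> H(5)] by metis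
    have "card (\<phi> ` H) \<noteq> 0" using H fH by simp
    then have "R \<in> ?R H" using Rf H by auto
    moreover have "\<phi> \<in> ?B H R f" using \<phi> Rf by auto
    ultimately show "\<phi> \<in> (\<Union>H\<in>?H. \<Union>R\<in>?R H. \<Union>f\<in>(H - R) \<rightarrow>\<^sub>E R. ?B H R f)"
      using \<open>H \<in> ?H\<close> Rf(4) by blast
  qed
  moreover have "finite (\<Union>H\<in>?H. \<Union>R\<in>?R H. \<Union>f\<in>(H - R) \<rightarrow>\<^sub>E R. ?B H R f)"
    by (rule finite_subset[of _ "?W \<rightarrow>\<^sub>E {..<M}"]) (use finS in \<open>auto simp: finite_PiE\<close>)
  ultimately have "card (?X - ?C ?W) \<le> card (\<Union>H\<in>?H. \<Union>R\<in>?R H. \<Union>f\<in>(H - R) \<rightarrow>\<^sub>E R. ?B H R f)"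
    by (rule card_mono[rotated])
  also have "\<dots> \<le> (\<Sum>H\<in>?H. card (\<Union>R\<in>?R H. \<Union>f\<in>(H - R) \<rightarrow>\<^sub>E R. ?B H R f))"
    by (rule card_UN_le[OF finH])
  also have "\<dots> \<le> (\<Sum>H\<in>?H. \<Sum>R\<in>?R H. card (\<Union>f\<in>(H - R) \<rightarrow>\<^sub>E R. ?B H R f))"
    by (intro sum_mono card_UN_le finR)
  also have "\<dots> \<le> (\<Sum>H\<in>?H. \<Sum>R\<in>?R H. \<Sum>f\<in>(H - R) \<rightarrow>\<^sub>E R. card (?B H R f))"
  proof (intro sum_mono card_UN_le)
    fix H R assume "H \<in> ?H" "R \<in> ?R H"
    then show "finite ((H - R) \<rightarrow>\<^sub>E R)"
      using finHH[of H] by (intro finite_PiE) (auto intro: finite_subset)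
  qed
  finally have "real (card (?X - ?C ?W))
      \<le> (\<Sum>H\<in>?H. \<Sum>R\<in>?R H. \<Sum>f\<in>(H - R) \<rightarrow>\<^sub>E R. real (card (?B H R f)))"
    by (simp flip: of_nat_sum)
  also have "\<dots> \<le> (\<Sum>H\<in>?H. card (?C S) * (\<beta> * (1 / (3 * (6 * real \<Delta>) ^ (card H - 1)))))"
  proof (rule sum_mono)
    fix H assume H: "H \<in> ?H"
    let ?n = "card H"
    \<comment> \<open>The bound for \<open>H\<close> is shared equally among the at most
      \<open>2 ^ (?n - 1)\<close> sets \<open>R \<subseteq> H - {v}\<close>.\<close>
    let ?c = "card (?C S) * (\<beta> * (1 / (3 * (6 * real \<Delta>) ^ (?n - 1)))) / 2 ^ (?n - 1)"
    have "(\<Sum>f\<in>(H - R) \<rightarrow>\<^sub>E R. real (card (?B H R f))) \<le> ?c" if R: "R \<in> ?R H" for R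
    proof -
      let ?q = "card R"
      have "finite R" using R finHH[OF H] by (auto intro: finite_subset)
      then have cHR: "card (H - R) = ?n - ?q" using R by (intro card_Diff_subset) auto
      have "(\<Sum>f\<in>(H - R) \<rightarrow>\<^sub>E R. real (card (?B H R f)))
          \<le> (\<Sum>f\<in>(H - R) \<rightarrow>\<^sub>E R. card (?C S) / \<beta> ^ (?n - ?q - 1))"
        using H R by (intro sum_mono cB) auto
      also have "\<dots> = real (?q ^ (?n - ?q)) * (card (?C S) / \<beta> ^ (?n - ?q - 1))"
        using finHH[OF H] by (simp only: sum_constant card_PiE prod_constant cHR finite_Diff)
      also have "\<dots> = card (?C S) * (2 ^ (?n - 1) * real ?q ^ (?n - ?q) / \<beta> ^ (?n - ?q - 1)) / 2 ^ (?n - 1)"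
        by (simp del: One_nat_def)
      also have "\<dots> \<le> ?c"
        using R assms by (intro divide_right_mono mult_left_mono weight_le) auto
      finally show ?thesis .
    qed
    then have "(\<Sum>R\<in>?R H. \<Sum>f\<in>(H - R) \<rightarrow>\<^sub>E R. real (card (?B H R f))) \<le> of_nat (card (?R H)) * ?c"
      by (rule sum_bounded_above)
    also have "\<dots> \<le> 2 ^ (?n - 1) * ?c"
    proof (rule mult_right_mono)
      have "card (?R H) \<le> card (Pow (H - {v}))"
        using finHH[OF H] by (intro card_mono) auto
      also have "\<dots> = 2 ^ (?n - 1)" using finHH[OF H] H by (simp add: card_Pow)
      finally show "real (card (?R H)) \<le> 2 ^ (?n - 1)"
        using of_nat_mono by fastforce
    qed (use \<beta>0 in auto)
    finally show "(\<Sum>R\<in>?R H. \<Sum>f\<in>(H - R) \<rightarrow>\<^sub>E R. real (card (?B H R f)))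
        \<le> card (?C S) * (\<beta> * (1 / (3 * (6 * real \<Delta>) ^ (?n - 1))))" by simp
  qed
  also have "\<dots> = card (?C S) * (\<beta> * (\<Sum>H\<in>?H. 1 / (3 * (6 * real \<Delta>) ^ (card H - 1))))"
    by (simp only: sum_distrib_left)
  also have "\<dots> \<le> card (?C S) * (\<beta> * 1)"
  \<comment> \<open>The percolation bound is applied inside \<open>?W\<close>, which inherits the
    degree bound from \<open>V\<close>.\<close>
  proof (intro mult_left_mono sum_linked_le_1)
    fix h assume "h \<in> ?W"
    then have "card {u \<in> V. E h u} \<le> \<Delta>" using deg less.prems by auto
    moreover have "card {u \<in> ?W. E h u} \<le> card {u \<in> V. E h u}"
      using less.prems \<open>finite V\<close> by (intro card_mono) auto
    ultimately show "card {u \<in> ?W. E h u} \<le> \<Delta>" by simp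
  qed (use finS assms \<beta>0 in auto)
  finally have bad: "real (card (?X - ?C ?W)) \<le> \<beta> * card (?C S)" by (simp add: mult.commute)
  have CX: "?C ?W \<subseteq> ?X" unfolding centered_colorings_def by (auto intro: centered_on_mono)
  have finX: "finite ?X" using finS by (simp add: finite_PiE)
  have "card (?X - ?C ?W) = card ?X - card (?C ?W)"
    by (rule card_Diff_subset[OF finite_subset[OF CX finX] CX])
  moreover have "card (?C ?W) \<le> card ?X" using CX finX by (rule card_mono[rotated])
  ultimately have "real (card (?C ?W)) = real (card ?X) - card (?X - ?C ?W)" by simp
  moreover have "real (card ?X) = real M * card (?C S)"
    using card_extensions[OF finS less.prems(2), of M p E] by simp
  moreover have "2 * \<beta> * card (?C S) \<le> real M * card (?C S)" using M by (intro mult_right_mono) auto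
  ultimately show ?case using bad by linarith
qed

section \<open>Transfer to graphs\<close>

lemma linked_if_connected:
  assumes "pair_graph H" "subgraph (with_proj H) (with_proj G)"
    and "Digraph_Component.connected (with_proj H)"
  shows "linked (\<lambda>u v. (u, v) \<in> parcs G) (pverts H)"
  unfolding linked_def
proof (intro allI impI, elim conjE)
  interpret H: pair_graph H by fact
  have sub: "parcs H \<subseteq> parcs G"
    using assms(2) by (auto simp: subgraph_def)
  \<comment> \<open>Connectedness refers to the symmetric closure, which adds no arcs here.\<close>
  have sym: "(parcs H)\<^sup>s = parcs H"
    using H.sym_arcs by (auto simp: symcl_def symmetric_def dest: symD)
  fix A assume A: "A \<subset> pverts H" "A \<noteq> {}"
  then obtain a b where ab: "a \<in> A" "b \<in> pverts H" "b \<notin> A" by blast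
  have "(a, b) \<in> rtrancl_on (pverts H) (parcs H)"
    using assms(3) A ab by (auto simp: connected_conv sym)
  \<comment> \<open>Follow a walk from \<open>a \<in> A\<close>: once it is outside
    \<open>A\<close>, some arc has crossed the cut.\<close>
  then have "b \<notin> A \<longrightarrow> (\<exists>a\<in>A. \<exists>b\<in>pverts H - A. (a, b) \<in> parcs H)"
    by (induction rule: rtrancl_on_induct) (use ab in auto)
  with ab sub show "\<exists>a\<in>A. \<exists>b\<in>pverts H - A. (a, b) \<in> parcs G" by blast
qed

lemma card_neighbors_le:
  assumes "pair_graph G" "max_degree G \<le> \<Delta>" "v \<in> pverts G"
  shows "card {u \<in> pverts G. (v, u) \<in> parcs G} \<le> \<Delta>"
proof -
  interpret pair_graph G by fact
  have "out_arcs (with_proj G) v = Pair v ` {u \<in> pverts G. (v, u) \<in> parcs G}"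
    using in_arcsD2 by (auto simp: out_arcs_def)
  then have "out_degree (with_proj G) v = card {u \<in> pverts G. (v, u) \<in> parcs G}"
    unfolding out_degree_def by (simp add: card_image inj_on_def)
  moreover have "out_degree (with_proj G) v \<le> max_degree G"
    unfolding max_degree_def using assms(3) pair_finite_verts by (intro Max_ge) auto
  ultimately show ?thesis using assms(2) by simp
qed

lemma exists_p_centered_coloring:
  assumes "1 \<le> p" "1 \<le> \<Delta>" "pair_graph G" "max_degree G \<le> \<Delta>"
    and M: "2 ^ 10 * real \<Delta> powr (2 - 1 / real p) * real p \<le> real M"
  shows "\<exists>\<phi>. p_centered p G \<phi> \<and> card (\<phi> ` pverts G) \<le> M"
proof -
  interpret pair_graph G by fact
  define \<beta> where "\<beta> = 256 * real \<Delta> powr (2 - 1 / real p) * real p"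
  \<comment> \<open>\<open>2 ^ 10\<close> is four times 256, so \<open>M\<close> even reaches
    \<open>4 * \<beta>\<close>.\<close>
  have \<beta>: "0 < \<beta>" "2 * \<beta> \<le> real M"
    using M assms(1,2) mult_nonneg_nonneg[of "real \<Delta> powr (2 - 1 / real p)" "real p"]
    unfolding \<beta>_def by auto
  let ?C = "centered_colorings p (\<lambda>u v. (u, v) \<in> parcs G) M"
  \<comment> \<open>Taking \<open>D = S\<close> descends to the empty set, whose single coloring
    makes the count positive.\<close>
  have "\<beta> ^ card (pverts G) * card (?C (pverts G - pverts G)) \<le> card (?C (pverts G))"
    using assms \<beta> card_neighbors_le[OF assms(3,4)] pair_finite_verts
    by (intro card_centered_colorings_Diff_le
          card_centered_colorings_insert_ge[where V = "pverts G" and \<Delta> = \<Delta>] \<beta>_def) auto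
  moreover have "?C {} = {\<lambda>_. undefined}"
    unfolding centered_colorings_def centered_on_def by auto
  ultimately have "0 < card (?C (pverts G))"
    using \<beta> by (metis Diff_cancel One_nat_def card.empty card_insert_disjoint empty_iff
        finite.emptyI gr0I mult.right_neutral not_le of_nat_0 of_nat_1 zero_less_power)
  then obtain \<phi> where "\<phi> \<in> ?C (pverts G)" by (auto simp: card_gt_0_iff)
  then have \<phi>: "\<phi> ` pverts G \<subseteq> {..<M}" "centered_on p (\<lambda>u v. (u, v) \<in> parcs G) (pverts G) \<phi>"
    unfolding centered_colorings_def by auto
  have "p_centered p G \<phi>"
    unfolding p_centered_def
  proof (intro allI impI, elim conjE)
    fix H :: "'a pair_pre_digraph"
    assume H: "pair_graph H" "subgraph (with_proj H) (with_proj G)"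
      "Digraph_Component.connected (with_proj H)"
    have "pverts H \<subseteq> pverts G" using H(2) by (auto simp: subgraph_def)
    moreover have "pverts H \<noteq> {}" using H(3) by (auto simp: connected_conv)
    ultimately show "card (\<phi> ` pverts H) > p \<or> (\<exists>c. \<exists>!v. v \<in> pverts H \<and> \<phi> v = c)"
      using linked_if_connected[OF H] \<phi>(2) unfolding centered_on_def by blast
  qed
  moreover have "card (\<phi> ` pverts G) \<le> M"
    using card_mono[OF _ \<phi>(1)] by simp
  ultimately show ?thesis by blast
qed

theorem theorem3:
  shows "(\<forall>p::nat. \<forall>\<Delta>::nat. \<forall>G :: 'a pair_pre_digraph.
            1 \<le> p \<and> 1 \<le> \<Delta> \<and> pair_graph G \<and> max_degree G \<le> \<Delta> \<longrightarrow>
            int (centered_chromatic_number p G)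
              \<le> \<lceil>2 ^ 10 * real \<Delta> powr (2 - 1 / real p) * real p\<rceil>)
       \<and> (\<forall>\<Delta>::nat. 1 \<le> \<Delta> \<longrightarrow>
            (\<exists>C::real. \<forall>p::nat. \<forall>G :: 'a pair_pre_digraph.
               1 \<le> p \<and> pair_graph G \<and> max_degree G \<le> \<Delta> \<longrightarrow>
               (\<exists>\<phi>. p_centered p G \<phi> \<and> real (card (\<phi> ` pverts G)) \<le> C * real p)))"
proof (intro conjI allI impI; (elim conjE)?)
  fix p \<Delta> :: nat and G :: "'a pair_pre_digraph"
  assume *: "1 \<le> p" "1 \<le> \<Delta>" "pair_graph G" "max_degree G \<le> \<Delta>"
  let ?b = "2 ^ 10 * real \<Delta> powr (2 - 1 / real p) * real p"
  have "?b \<le> real (nat \<lceil>?b\<rceil>)" by (rule real_nat_ceiling_ge)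
  from exists_p_centered_coloring[OF * this] obtain \<phi>
    where \<phi>: "p_centered p G \<phi>" "card (\<phi> ` pverts G) \<le> nat \<lceil>?b\<rceil>" by blast
  then have "centered_chromatic_number p G \<le> card (\<phi> ` pverts G)"
    unfolding centered_chromatic_number_def by (intro Least_le) blast
  \<comment> \<open>Nonnegativity ensures that \<open>nat\<close> does not alter the
    ceiling.\<close>
  moreover have "0 \<le> \<lceil>?b\<rceil>"
  proof -
    have "0 \<le> ?b" by simp
    then show ?thesis by linarith
  qed
  ultimately show "int (centered_chromatic_number p G) \<le> \<lceil>?b\<rceil>"
    using \<phi>(2) by linarith
next
  fix \<Delta> :: nat
  assume \<Delta>: "1 \<le> \<Delta>"
  show "\<exists>C::real. \<forall>p::nat. \<forall>G :: 'a pair_pre_digraph.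
          1 \<le> p \<and> pair_graph G \<and> max_degree G \<le> \<Delta> \<longrightarrow>
          (\<exists>\<phi>. p_centered p G \<phi> \<and> real (card (\<phi> ` pverts G)) \<le> C * real p)"
  \<comment> \<open>As \<open>2 - 1 / p \<le> 2\<close> and \<open>\<Delta> \<ge> 1\<close>, the
    factor \<open>\<Delta> ^ 2\<close> serves all \<open>p\<close> at once.\<close>
  proof (intro exI[of _ "real (2 ^ 10 * \<Delta> ^ 2)"] allI impI, elim conjE)
    fix p :: nat and G :: "'a pair_pre_digraph"
    assume *: "1 \<le> p" "pair_graph G" "max_degree G \<le> \<Delta>"
    have "real \<Delta> powr (2 - 1 / real p) \<le> real \<Delta> powr 2"
      using \<Delta> by (intro powr_mono) auto
    also have "\<dots> = real \<Delta> ^ 2" using \<Delta> by (simp add: powr_numeral)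
    finally have "2 ^ 10 * real \<Delta> powr (2 - 1 / real p) * real p \<le> real (2 ^ 10 * \<Delta> ^ 2 * p)"
      by (simp add: mult_right_mono)
    from exists_p_centered_coloring[OF *(1) \<Delta> *(2,3) this] obtain \<phi>
      where "p_centered p G \<phi>" "card (\<phi> ` pverts G) \<le> 2 ^ 10 * \<Delta> ^ 2 * p" by blast
    then show "\<exists>\<phi>. p_centered p G \<phi> \<and> real (card (\<phi> ` pverts G)) \<le> real (2 ^ 10 * \<Delta> ^ 2) * real p"
      by (metis of_nat_le_iff of_nat_mult)
  qed
qed

end
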